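(* Let $k\ge 1$, let $\Sigma$ be a totally ordered alphabet of $k$ symbols and let $N$ be a finite non-empty totally ordered set. The map $\zeta$ (defined in the context), which sends a $2m^k$-parking function $(Q_j)$ on $N$ to an automaton structure $(A,\delta)$ on $N$, is a bijection from the set of $2m^k$-parking functions on $N$ onto the set of non-initial acyclic deterministic finite automata with state set $N$ over $\Sigma$.
   Context: Parking functions. Let $n=\#N$. A $2m^k$-parking function on $N$ is encoded as a sequence $(Q_j)_{1\le j\le 2n^k}$ of pairwise disjoint (possibly empty) subsets of $N$ with union $N$ such that $\sum_{j=1}^{2p^k}\#Q_j\ge p$ for all $p\in\{1,\dots,n\}$. Automata. A non-initial DFA with state set $N$ over $\Sigma$ is a pair $(A,\delta)$ with $A\subseteq N$ (accepting states) and $\delta:N\times\Sigma\to N\cup\{\emptyset\}$, where $\emptyset\notin N$ is a special symbol, the absorbing state (with no outgoing transitions). It is acyclic (a non-initial ADFA) if no non-empty sequence of transitions leads from a state of $N$ back to itself. For $q\in N$, $\delta_q:\Sigma\to N\cup\{\emptyset\}$ is $\delta_q(a)=\delta(q,a)$. The map $\zeta$. Let $<_N$ be the given total order on $N$ and $a_1<\dots<a_k$ the symbols of $\Sigma$. Given a $2m^k$-parking function $(Q_j)$ on $N$, define a total order $<_q$ on $N$ by: $x<_q y$ iff $x\in Q_j$, $y\in Q_{j'}$ with $j<j'$, or $x,y\in Q_j$ for the same $j$ and $x<_N y$. Let $q_1<_q q_2<_q\dots<_q q_n$ be the elements of $N$ and put $q_0:=\emptyset$, with $q_0<_q q_1$.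 For $p\in\{1,\dots,n\}$ there are exactly $p^k-(p-1)^k$ maps $\nu:\Sigma\to\{q_0,q_1,\dots,q_{p-1}\}$ with $\nu(a)=q_{p-1}$ for at least one $a\in\Sigma$; let $\nu^{(p)}_1<\nu^{(p)}_2<\dots<\nu^{(p)}_{p^k-(p-1)^k}$ be these maps, ordered lexicographically by the words $\nu(a_1)\nu(a_2)\cdots\nu(a_k)$ with letters ordered by $<_q$. Then $\zeta((Q_j)):=(A,\delta)$, where $A$ is the union of the $Q_j$ with $j$ even, and for $q\in N$, $\delta_q:=\nu^{(p)}_j$ for the unique $p\in\{1,\dots,n\}$ and $j\in\{1,\dots,p^k-(p-1)^k\}$ such that $q\in Q_{2(p-1)^k+2j-1}$ or $q\in Q_{2(p-1)^k+2j}$. *)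

theory Defs
  imports "HOL-Library.Cardinality" "HOL-Library.Disjoint_Sets"
begin

text \<open>The set \<open>N\<close> is the universe of a type of sort \<open>{finite, linorder}\<close>, and so is the
  alphabet; the numbers \<open>n\<close> and \<open>k\<close> are the cardinalities of these types, so both are positive.
  The absorbing state is \<open>None\<close>, and a state \<open>q\<close> of \<open>N\<close> occurs as \<open>Some q\<close> as the target of a
  transition.\<close>

text \<open>Sequences are indexed from 1. To make equality of functions the equality of
  sequences, the values outside the index range are fixed to be empty.\<close>

definition parking_functions :: "nat \<Rightarrow> (nat \<Rightarrow> 'n::finite set) set" where
  "parking_functions k = {Q.
     (\<forall>j. j \<notin> {1..2 * CARD('n) ^ k} \<longrightarrow> Q j = {}) \<and>
     disjoint_family_on Q {1..2 * CARD('n) ^ k} \<and>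
     (\<Union>j\<in>{1..2 * CARD('n) ^ k}. Q j) = UNIV \<and>
     (\<forall>p\<in>{1..CARD('n)}. p \<le> (\<Sum>j=1..2 * p ^ k. card (Q j)))}"

type_synonym ('n, 's) automaton = "'n set \<times> ('n \<Rightarrow> 's \<Rightarrow> 'n option)"

definition transitions :: "('n \<Rightarrow> 's \<Rightarrow> 'n option) \<Rightarrow> ('n \<times> 'n) set" where
  "transitions \<delta> = {(q, r). \<exists>a. \<delta> q a = Some r}"

definition non_initial_adfas :: "('n, 's) automaton set" where
  "non_initial_adfas = {(A, \<delta>). acyclic (transitions \<delta>)}"

text \<open>The elements of a finite set \<open>S\<close> listed in increasing order, for a strict order \<open>R\<close>
  that is total on \<open>S\<close>.\<close>

definition increasing_list :: "('b \<Rightarrow> 'b \<Rightarrow> bool) \<Rightarrow> 'b set \<Rightarrow> 'b list" where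
  "increasing_list R S = (THE xs. sorted_wrt R xs \<and> set xs = S)"

definition less_q :: "(nat \<Rightarrow> 'n::linorder set) \<Rightarrow> 'n \<Rightarrow> 'n \<Rightarrow> bool" where
  "less_q Q x y \<longleftrightarrow>
     (\<exists>j j'. x \<in> Q j \<and> y \<in> Q j' \<and> j < j') \<or> (\<exists>j. x \<in> Q j \<and> y \<in> Q j \<and> x < y)"

fun less_q_option :: "(nat \<Rightarrow> 'n::linorder set) \<Rightarrow> 'n option \<Rightarrow> 'n option \<Rightarrow> bool" where
  "less_q_option Q None None \<longleftrightarrow> False"
| "less_q_option Q None (Some y) \<longleftrightarrow> True"
| "less_q_option Q (Some x) None \<longleftrightarrow> False"
| "less_q_option Q (Some x) (Some y) \<longleftrightarrow> less_q Q x y"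

text \<open>\<open>nth_q Q p\<close> is \<open>q\<^sub>p\<close> for \<open>p \<le> n\<close>, with \<open>q\<^sub>0\<close> the absorbing state.\<close>

definition nth_q :: "(nat \<Rightarrow> 'n::{finite,linorder} set) \<Rightarrow> nat \<Rightarrow> 'n option" where
  "nth_q Q p = (if p = 0 then None else Some (increasing_list (less_q Q) UNIV ! (p - 1)))"

definition word_of :: "('s::{finite,linorder} \<Rightarrow> 'b) \<Rightarrow> 'b list" where
  "word_of \<nu> = map \<nu> (sorted_list_of_set UNIV)"

definition less_lex ::
  "(nat \<Rightarrow> 'n::linorder set) \<Rightarrow> ('s::{finite,linorder} \<Rightarrow> 'n option) \<Rightarrow> ('s \<Rightarrow> 'n option) \<Rightarrow> bool"
where
  "less_lex Q \<nu> \<mu> \<longleftrightarrow> (word_of \<nu>, word_of \<mu>) \<in> lexord {(u, v). less_q_option Q u v}"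

definition level_maps ::
  "(nat \<Rightarrow> 'n::{finite,linorder} set) \<Rightarrow> nat \<Rightarrow> ('s \<Rightarrow> 'n option) set"
where
  "level_maps Q p = {\<nu>. range \<nu> \<subseteq> nth_q Q ` {0..p - 1} \<and> (\<exists>a. \<nu> a = nth_q Q (p - 1))}"

text \<open>\<open>nth_map Q p j\<close> is the \<open>j\<close>-th map at level \<open>p\<close>, for \<open>p\<close> and \<open>j\<close> counted from 1.\<close>

definition nth_map ::
  "(nat \<Rightarrow> 'n::{finite,linorder} set) \<Rightarrow> nat \<Rightarrow> nat \<Rightarrow> 's::{finite,linorder} \<Rightarrow> 'n option"
where
  "nth_map Q p j = increasing_list (less_lex Q) (level_maps Q p) ! (j - 1)"

definition accepting :: "nat \<Rightarrow> (nat \<Rightarrow> 'n::finite set) \<Rightarrow> 'n set" where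
  "accepting k Q = (\<Union>j\<in>{j\<in>{1..2 * CARD('n) ^ k}. even j}. Q j)"

definition position :: "nat \<Rightarrow> (nat \<Rightarrow> 'n::finite set) \<Rightarrow> 'n \<Rightarrow> nat \<times> nat" where
  "position k Q q = (THE (p, j). p \<in> {1..CARD('n)} \<and> j \<in> {1..p ^ k - (p - 1) ^ k} \<and>
     (q \<in> Q (2 * (p - 1) ^ k + 2 * j - 1) \<or> q \<in> Q (2 * (p - 1) ^ k + 2 * j)))"

definition zeta ::
  "(nat \<Rightarrow> 'n::{finite,linorder} set) \<Rightarrow> ('n, 's::{finite,linorder}) automaton"
where
  "zeta Q = (accepting CARD('s) Q, \<lambda>q. case position CARD('s) Q q of (p, j) \<Rightarrow> nth_map Q p j)"

end

theory Submission
  imports Defs "HOL-Library.FuncSet" "HOL-Library.Product_Lexorder" "HOL-Library.List_Lexorder"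
begin

text \<open>
  A parking function \<open>Q\<close> amounts to the map that sends a state to the index of its block, and the
  order \<open><\<^sub>q\<close> then compares the pairs (block index, state). It numbers the states from 1 to \<open>n\<close>; the
  absorbing state gets the number 0. Through this numbering a map from the alphabet to the states and
  \<open>\<emptyset>\<close> becomes a map \<open>\<nu>\<close> from the alphabet to the natural numbers. Those are enumerated once and for
  all, independently of \<open>Q\<close>, by increasing maximum and then lexicographically; let \<open>code \<nu>\<close> be the
  place of \<open>\<nu>\<close>, counted from 0. There are \<open>p\<^sup>k\<close> maps with values below \<open>p\<close>, so
  \<open>code \<nu> < p\<^sup>k\<close> exactly when all values of \<open>\<nu>\<close> are below \<open>p\<close> (\<open>code_less_power_iff\<close>). Hence the
  definition of \<open>\<zeta>\<close> says just this (\<open>block_of_zeta\<close>): if \<open>\<zeta>(Q) = (A, \<delta>)\<close> and \<open>r\<close> is the numbering that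
  \<open>Q\<close> induces, then the block of \<open>q\<close> has index \<open>2 code(r \<circ> \<delta>\<^sub>q) + 1\<close>, or one more if \<open>q\<close> accepts.
  In particular \<open>Q\<close> is determined by \<open>A\<close>, \<open>\<delta>\<close> and \<open>r\<close>.

  It remains to recover \<open>r\<close> from \<open>(A, \<delta>)\<close>. The parking condition says that, for each \<open>p\<close>, the first \<open>p\<close>
  states lie in the first \<open>2p\<^sup>k\<close> blocks, that is, that every transition leads to a state of smaller number.
  This gives acyclicity. Moreover, when the first \<open>p\<close> states are known, the next one is forced: among
  the other states whose transitions lead only to numbered states or to \<open>\<emptyset>\<close>, it is the one with the
  least pair (block index, state), and this pair depends only on the numbers already given. So at most
  one numbering is compatible with \<open>(A, \<delta>)\<close> (\<open>greedy_unique\<close>). If \<open>\<delta>\<close> is acyclic, the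
  greedy choice never gets stuck (\<open>greedy_exists\<close>), and the numbering that it produces comes from a
  parking function (\<open>parking_function_of_greedy\<close>).
\<close>

section \<open>Lists sorted by an injective key\<close>

lemma sorted_wrt_key_list:
  fixes f :: "'b \<Rightarrow> 'c::linorder"
  assumes inj: "inj_on f S"
    and key: "\<And>x y. x \<in> S \<Longrightarrow> y \<in> S \<Longrightarrow> R x y \<longleftrightarrow> f x < f y"
    and fin: "finite S"
  shows "sorted_wrt R (increasing_list R S)" and "set (increasing_list R S) = S"
proof -
  define xs where "xs = map (inv_into S f) (sorted_list_of_set (f ` S))"
  have set_xs: "set xs = S"
    using inj fin by (auto simp: xs_def image_image)
  have map_sorted: "sorted_wrt R ys \<longleftrightarrow> sorted_wrt (<) (map f ys)" if "set ys = S" for ys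
    unfolding sorted_wrt_map using that key
    by (auto intro: sorted_wrt_mono_rel[rotated])
  have "map f xs = sorted_list_of_set (f ` S)"
    using fin by (auto simp: xs_def f_inv_into_f intro!: map_idI)
  then have sorted_xs: "sorted_wrt R xs"
    using map_sorted[OF set_xs] by simp
  have unique: "ys = xs" if "sorted_wrt R ys \<and> set ys = S" for ys
  proof -
    have "map f ys = map f xs"
      using that sorted_xs set_xs map_sorted by (intro strict_sorted_equal) auto
    moreover have "inj_on f (set ys \<union> set xs)"
      using inj that set_xs by simp
    ultimately show ?thesis
      using map_inj_on by blast
  qed
  have "increasing_list R S = xs"
    unfolding increasing_list_def
  proof (rule the_equality)
    show "sorted_wrt R xs \<and> set xs = S"
      using sorted_xs set_xs ..
  qed (rule unique)
  then show "sorted_wrt R (increasing_list R S)" "set (increasing_list R S) = S"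
    using sorted_xs set_xs by simp_all
qed

text \<open>A position in an increasing list becomes a cardinality here, which a bijection that respects
  the orders preserves; so no list has to be compared with another one.\<close>

lemma increasing_list_nth_rank:
  fixes f :: "'b \<Rightarrow> 'c::linorder"
  assumes inj: "inj_on f S"
    and key: "\<And>x y. x \<in> S \<Longrightarrow> y \<in> S \<Longrightarrow> R x y \<longleftrightarrow> f x < f y"
    and fin: "finite S" and x: "x \<in> S"
  shows "increasing_list R S ! card {y \<in> S. f y < f x} = x"
proof -
  define xs where "xs = increasing_list R S"
  have sorted: "sorted_wrt R xs" and set_xs: "set xs = S"
    using sorted_wrt_key_list[OF inj key fin] by (simp_all add: xs_def)
  have mono: "f (xs ! i) < f (xs ! j)" if "i < j" "j < length xs" for i j
    using sorted_wrt_nth_less[OF sorted that] that set_xs key by (metis nth_mem order_less_trans)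
  obtain i where i: "i < length xs" "xs ! i = x"
    using x set_xs by (metis in_set_conv_nth)
  have below: "f (xs ! j) < f x \<longleftrightarrow> j < i" if "j < length xs" for j
    using mono[of j i] mono[of i j] that i by (cases "i < j") (auto simp: not_less_iff_gr_or_eq)
  have "{y \<in> S. f y < f x} = (!) xs ` {..<i}"
  proof
    show "{y \<in> S. f y < f x} \<subseteq> (!) xs ` {..<i}"
      using below set_xs by (auto simp: in_set_conv_nth)
    show "(!) xs ` {..<i} \<subseteq> {y \<in> S. f y < f x}"
      using below set_xs i(1) by auto
  qed
  moreover have "inj_on ((!) xs) {..<i}"
    using mono i(1) by (intro linorder_inj_onI) (force, auto)
  ultimately show ?thesis
    using i by (simp add: card_image xs_def)
qed

lemma rank_less_iff:
  fixes f :: "'b \<Rightarrow> 'c::linorder"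
  assumes "finite {y. f y < f x}" "finite {y. f y < f z}"
  shows "card {y. f y < f x} < card {y. f y < f z} \<longleftrightarrow> f x < f z"
proof (cases "f x < f z")
  case True
  then have "{y. f y < f x} \<subset> {y. f y < f z}"
    using order.strict_trans[of _ "f x" "f z"] by blast
  then show ?thesis
    using True assms by (simp add: psubset_card_mono)
next
  case False
  then have "{y. f y < f z} \<subseteq> {y. f y < f x}"
    by auto
  then show ?thesis
    using False assms by (meson card_mono leD)
qed

section \<open>Numbering the maps from the alphabet to the natural numbers\<close>

definition peak :: "('s::finite \<Rightarrow> nat) \<Rightarrow> nat" where
  "peak \<nu> = Max (range \<nu>)"

text \<open>With the lexicographic orders on pairs and lists, comparing \<open>word_key\<close> means comparing maxima
  first and words second. The levels of the definition of \<open>\<zeta>\<close>, one after the other, thus form a single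
  linear order on maps into the natural numbers.\<close>

definition word_key :: "('s::{finite,linorder} \<Rightarrow> nat) \<Rightarrow> nat \<times> nat list" where
  "word_key \<nu> = (peak \<nu>, word_of \<nu>)"

definition code :: "('s::{finite,linorder} \<Rightarrow> nat) \<Rightarrow> nat" where
  "code \<nu> = card {\<mu> :: 's \<Rightarrow> nat. word_key \<mu> < word_key \<nu>}"

lemma word_of_eq_iff: "word_of \<mu> = word_of \<nu> \<longleftrightarrow> \<mu> = \<nu>"
  by (auto simp: word_of_def)

lemma word_key_eq_iff: "word_key \<mu> = word_key \<nu> \<longleftrightarrow> \<mu> = \<nu>"
  by (auto simp: word_key_def word_of_eq_iff)

lemma peak_less_iff: "peak \<nu> < p \<longleftrightarrow> (\<forall>a. \<nu> a < p)"
  by (auto simp: peak_def)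

lemma peak_eq_iff: "peak \<nu> = m \<longleftrightarrow> (\<forall>a. \<nu> a \<le> m) \<and> (\<exists>a. \<nu> a = m)"
  unfolding peak_def by (subst Max_eq_iff) auto

lemma maps_below:
  fixes p :: nat
  shows "finite {\<nu> :: 's::finite \<Rightarrow> nat. peak \<nu> < p}"
    and "card {\<nu> :: 's::finite \<Rightarrow> nat. peak \<nu> < p} = p ^ CARD('s)"
proof -
  have "{\<nu> :: 's \<Rightarrow> nat. peak \<nu> < p} = (UNIV \<rightarrow>\<^sub>E {..<p})"
    by (auto simp: peak_less_iff PiE_def)
  then show "finite {\<nu> :: 's \<Rightarrow> nat. peak \<nu> < p}"
    and "card {\<nu> :: 's::finite \<Rightarrow> nat. peak \<nu> < p} = p ^ CARD('s)"
    by (simp_all add: finite_PiE card_funcsetE)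
qed

lemma finite_code: "finite {\<mu> :: 's::{finite,linorder} \<Rightarrow> nat. word_key \<mu> < word_key \<nu>}"
  by (rule finite_subset[OF _ maps_below(1)[of "Suc (peak \<nu>)"]])
    (auto simp: word_key_def less_Suc_eq_le)

lemma code_less_iff:
  fixes \<mu> \<nu> :: "'s::{finite,linorder} \<Rightarrow> nat"
  shows "code \<mu> < code \<nu> \<longleftrightarrow> word_key \<mu> < word_key \<nu>"
  unfolding code_def by (rule rank_less_iff[where f = word_key, OF finite_code finite_code])

lemma code_eq_iff:
  fixes \<mu> \<nu> :: "'s::{finite,linorder} \<Rightarrow> nat"
  shows "code \<mu> = code \<nu> \<longleftrightarrow> \<mu> = \<nu>"
  using code_less_iff[of \<mu> \<nu>] code_less_iff[of \<nu> \<mu>] word_key_eq_iff[of \<mu> \<nu>]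
  by (metis linorder_neq_iff)

lemma code_less_if_peak_less:
  fixes \<mu> \<nu> :: "'s::{finite,linorder} \<Rightarrow> nat"
  shows "peak \<mu> < peak \<nu> \<Longrightarrow> code \<mu> < code \<nu>"
  by (simp add: code_less_iff word_key_def)

text \<open>The maps with all values below \<open>p\<close> form an initial segment of the order, with \<open>p ^ CARD('s)\<close>
  elements. This is what links the bounds \<open>2 p\<^sup>k\<close> of the parking condition to the targets of
  transitions.\<close>

lemma code_less_power_iff:
  fixes \<nu> :: "'s::{finite,linorder} \<Rightarrow> nat"
  shows "code \<nu> < p ^ CARD('s) \<longleftrightarrow> peak \<nu> < p"
proof (cases "peak \<nu> < p")
  case True
  then have "{\<mu>. word_key \<mu> < word_key \<nu>} \<subset> {\<mu> :: 's \<Rightarrow> nat. peak \<mu> < p}"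
    by (auto simp: word_key_def)
  then show ?thesis
    using True psubset_card_mono[OF maps_below(1)] by (metis code_def maps_below(2))
next
  case False
  then have "{\<mu> :: 's \<Rightarrow> nat. peak \<mu> < p} \<subseteq> {\<mu>. word_key \<mu> < word_key \<nu>}"
    by (auto simp: word_key_def)
  then have "p ^ CARD('s) \<le> code \<nu>"
    unfolding code_def using card_mono[OF finite_code] maps_below(2)[of p] by metis
  then show ?thesis
    using False by simp
qed

lemma code_surj_on:
  assumes "c < p ^ CARD('s::{finite,linorder})"
  obtains \<nu> :: "'s::{finite,linorder} \<Rightarrow> nat" where "code \<nu> = c" "peak \<nu> < p"
proof -
  let ?M = "{\<nu> :: 's \<Rightarrow> nat. peak \<nu> < p}"
  have "inj_on code ?M"
    by (auto simp: inj_on_def code_eq_iff)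
  then have "card (code ` ?M) = card {..<p ^ CARD('s)}"
    by (simp add: card_image maps_below(2))
  moreover have "code ` ?M \<subseteq> {..<p ^ CARD('s)}"
    by (auto simp: code_less_power_iff)
  ultimately have "code ` ?M = {..<p ^ CARD('s)}"
    by (intro card_subset_eq) auto
  then show ?thesis
    using assms that by (smt (verit, best) image_iff lessThan_iff mem_Collect_eq)
qed

text \<open>All the maps with smaller maximum come first, so the place of a map within its level is offset
  by the total size of the levels below it.\<close>

lemma code_eq_level_rank:
  fixes \<nu> :: "'s::{finite,linorder} \<Rightarrow> nat"
  shows "code \<nu> = peak \<nu> ^ CARD('s)
    + card {\<mu> :: 's \<Rightarrow> nat. peak \<mu> = peak \<nu> \<and> word_of \<mu> < word_of \<nu>}"
proof -
  let ?m = "peak \<nu>"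
  let ?L = "{\<mu> :: 's \<Rightarrow> nat. peak \<mu> = ?m \<and> word_of \<mu> < word_of \<nu>}"
  have split: "{\<mu>. word_key \<mu> < word_key \<nu>} = {\<mu>. peak \<mu> < ?m} \<union> ?L"
    by (auto simp: word_key_def)
  moreover have "finite ?L"
    by (rule finite_subset[OF _ finite_code[of \<nu>]]) (auto simp: word_key_def)
  ultimately show ?thesis
    unfolding code_def split using maps_below[where 's = 's, of ?m]
    by (subst card_Un_disjoint) auto
qed

section \<open>The numbering of the states induced by a parking function\<close>

definition block :: "(nat \<Rightarrow> 'n set) \<Rightarrow> 'n \<Rightarrow> nat" where
  "block Q q = (THE j. q \<in> Q j)"

text \<open>For a parking function this is the place of a state in the order \<open><\<^sub>q\<close>, and so the inverse
  of \<open>nth_q\<close>: comparing the pairs of block index and state is the same as comparing by \<open><\<^sub>q\<close>.\<close>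

definition number :: "(nat \<Rightarrow> 'n::{finite,linorder} set) \<Rightarrow> 'n option \<Rightarrow> nat" where
  "number Q x = (case x of None \<Rightarrow> 0
     | Some q \<Rightarrow> Suc (card {y. (block Q y, y) < (block Q q, q)}))"

lemma number_simps [simp]:
  "number Q None = 0"
  "number Q (Some q) = Suc (card {y. (block Q y, y) < (block Q q, q)})"
  by (simp_all add: number_def)

lemma number_less_iff:
  "number Q (Some x) < number Q (Some y) \<longleftrightarrow> (block Q x, x) < (block Q y, y)"
  unfolding number_simps Suc_less_eq by (rule rank_less_iff) simp_all

lemma inj_number: "inj (number Q)"
proof (rule injI)
  fix x y assume eq: "number Q x = number Q y"
  show "x = y"
  proof (cases x; cases y)
    fix a b assume ab: "x = Some a" "y = Some b"
    then have "\<not> (block Q a, a) < (block Q b, b)" "\<not> (block Q b, b) < (block Q a, a)"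
      using eq number_less_iff[of Q a b] number_less_iff[of Q b a] by auto
    then show ?thesis
      using ab by (auto simp: not_less)
  qed (use eq in auto)
qed

lemma range_number:
  fixes Q :: "nat \<Rightarrow> 'n::{finite,linorder} set"
  shows "range (number Q) = {0..CARD('n)}"
proof (rule card_subset_eq)
  show "range (number Q) \<subseteq> {0..CARD('n)}"
  proof clarify
    fix x show "number Q x \<in> {0..CARD('n)}"
    proof (cases x)
      case (Some q)
      have "{y. (block Q y, y) < (block Q q, q)} \<subset> UNIV"
        by blast
      then show ?thesis
        using Some psubset_card_mono[of "UNIV :: 'n set"] by (simp add: Suc_le_eq)
    qed simp
  qed
  show "card (range (number Q)) = card {0..CARD('n)}"
    using inj_number[of Q] by (simp add: card_image card_UNIV_option)
qed simp

lemma inj_block_key: "inj (\<lambda>x. (block Q x, x))"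
  by (auto intro: injI)

lemma mem_parking_function_iff:
  fixes Q :: "nat \<Rightarrow> 'n::finite set"
  assumes "Q \<in> parking_functions k"
  shows "q \<in> Q j \<longleftrightarrow> block Q q = j"
proof -
  have Q: "\<forall>j. j \<notin> {1..2 * CARD('n) ^ k} \<longrightarrow> Q j = {}"
    and disj: "disjoint_family_on Q {1..2 * CARD('n) ^ k}"
    and cover: "(\<Union>j\<in>{1..2 * CARD('n) ^ k}. Q j) = UNIV"
    using assms unfolding parking_functions_def by blast+
  have unique: "i = j" if "q \<in> Q i" "q \<in> Q j" for i j
    using that Q disj unfolding disjoint_family_on_def by blast
  moreover obtain i where "q \<in> Q i"
    using cover by blast
  ultimately show ?thesis
    unfolding block_def by (metis the_equality)
qed

lemma block_bounds:
  fixes Q :: "nat \<Rightarrow> 'n::finite set"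
  assumes "Q \<in> parking_functions k"
  shows "1 \<le> block Q q" "block Q q \<le> 2 * CARD('n) ^ k"
proof -
  have "block Q q \<in> {1..2 * CARD('n) ^ k}"
    using assms mem_parking_function_iff[OF assms, of q "block Q q"]
    unfolding parking_functions_def by blast
  then show "1 \<le> block Q q" "block Q q \<le> 2 * CARD('n) ^ k"
    by simp_all
qed

lemma sum_card_eq_card_block_le:
  fixes f :: "'n::finite \<Rightarrow> nat"
  assumes mem: "\<And>q j. q \<in> Q j \<longleftrightarrow> f q = j" and pos: "\<And>q. 1 \<le> f q"
  shows "(\<Sum>j=1..m. card (Q j)) = card {q. f q \<le> m}"
proof -
  have "card (\<Union>j\<in>{1..m}. Q j) = (\<Sum>j=1..m. card (Q j))"
    by (rule card_UN_disjoint) (auto simp: mem)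
  moreover have "(\<Union>j\<in>{1..m}. Q j) = {q. f q \<le> m}"
    using pos by (auto simp: mem)
  ultimately show ?thesis
    by simp
qed

lemma less_q_iff:
  assumes "Q \<in> parking_functions k"
  shows "less_q Q x y \<longleftrightarrow> (block Q x, x) < (block Q y, y)"
  using mem_parking_function_iff[OF assms] by (auto simp: less_q_def)

lemma less_q_option_iff:
  assumes "Q \<in> parking_functions k"
  shows "less_q_option Q x y \<longleftrightarrow> number Q x < number Q y"
  by (cases x; cases y)
    (use number_less_iff in \<open>auto simp: less_q_iff[OF assms] simp del: number_simps(2)\<close>,
      simp_all)

lemma nth_q_number:
  assumes "Q \<in> parking_functions k"
  shows "nth_q Q (number Q x) = x"
  using increasing_list_nth_rank[OF inj_block_key, where R = "less_q Q"] less_q_iff[OF assms]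
  by (cases x) (auto simp: nth_q_def)

lemma nth_q_eq_iff:
  fixes Q :: "nat \<Rightarrow> 'n::{finite,linorder} set"
  assumes "Q \<in> parking_functions k" "p \<le> CARD('n)"
  shows "x = nth_q Q p \<longleftrightarrow> number Q x = p"
proof -
  have "p \<in> range (number Q)"
    using assms(2) by (simp add: range_number)
  then show ?thesis
    using nth_q_number[OF assms(1)] inj_number[of Q] by (auto dest: injD)
qed


lemma number_comp_nth_q:
  fixes Q :: "nat \<Rightarrow> 'n::{finite,linorder} set"
  assumes Q: "Q \<in> parking_functions k" and "peak \<mu> \<le> CARD('n)"
  shows "number Q \<circ> (nth_q Q \<circ> \<mu>) = \<mu>"
proof
  fix a
  have "\<mu> a \<le> CARD('n)"
    using assms(2) peak_eq_iff[of \<mu> "peak \<mu>"] le_trans by blast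
  then show "(number Q \<circ> (nth_q Q \<circ> \<mu>)) a = \<mu> a"
    using nth_q_eq_iff[OF Q, of "\<mu> a" "nth_q Q (\<mu> a)"] by simp
qed

section \<open>The transitions of the image of a parking function\<close>

lemma level_maps_iff:
  fixes Q :: "nat \<Rightarrow> 'n::{finite,linorder} set" and \<nu> :: "'s::finite \<Rightarrow> 'n option"
  assumes Q: "Q \<in> parking_functions k" and m: "m < CARD('n)"
  shows "\<nu> \<in> level_maps Q (Suc m) \<longleftrightarrow> peak (number Q \<circ> \<nu>) = m"
proof -
  have "range \<nu> \<subseteq> nth_q Q ` {0..m} \<longleftrightarrow> (\<forall>a. number Q (\<nu> a) \<le> m)"
    using nth_q_eq_iff[OF Q] nth_q_number[OF Q] m
    by (force simp: image_subset_iff image_iff)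
  moreover have "(\<exists>a. \<nu> a = nth_q Q m) \<longleftrightarrow> (\<exists>a. number Q (\<nu> a) = m)"
    using nth_q_eq_iff[OF Q, of m] m by simp
  ultimately show ?thesis
    by (auto simp: level_maps_def image_iff peak_eq_iff)
qed

lemma lexord_map_iff:
  fixes f :: "'b \<Rightarrow> 'c::linorder"
  assumes "inj f" and "length us = length vs"
  shows "(us, vs) \<in> lexord {(u, v). f u < f v} \<longleftrightarrow> map f us < map f vs"
  using assms(2)
  by (induction us vs rule: list_induct2) (auto simp: list_less_def inj_eq[OF assms(1)])

lemma less_lex_iff:
  assumes "Q \<in> parking_functions k"
  shows "less_lex Q \<nu> \<mu> \<longleftrightarrow> word_of (number Q \<circ> \<nu>) < word_of (number Q \<circ> \<mu>)"
  unfolding less_lex_def less_q_option_iff[OF assms] word_of_def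
  by (subst lexord_map_iff[OF inj_number]) simp_all

text \<open>Composition with the numbering identifies the level of \<open>Q\<close> with a level of the fixed enumeration
  by \<open>code\<close>, so that ranks can be computed there.\<close>

lemma bij_betw_number_level:
  fixes Q :: "nat \<Rightarrow> 'n::{finite,linorder} set"
  assumes Q: "Q \<in> parking_functions k" and m: "m < CARD('n)"
  shows "bij_betw ((\<circ>) (number Q)) (level_maps Q (Suc m))
    {\<mu> :: 's::finite \<Rightarrow> nat. peak \<mu> = m}"
proof (rule bij_betw_imageI)
  show "inj_on ((\<circ>) (number Q)) (level_maps Q (Suc m))"
    by (rule inj_onI) (simp add: fun.inj_map_strong inj_number inj_eq fun_eq_iff)
  show "(\<circ>) (number Q) ` level_maps Q (Suc m) = {\<mu> :: 's \<Rightarrow> nat. peak \<mu> = m}"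
  proof
    show "(\<circ>) (number Q) ` level_maps Q (Suc m) \<subseteq> {\<mu> :: 's \<Rightarrow> nat. peak \<mu> = m}"
      using level_maps_iff[OF Q m] by auto
    show "{\<mu> :: 's \<Rightarrow> nat. peak \<mu> = m} \<subseteq> (\<circ>) (number Q) ` level_maps Q (Suc m)"
    proof clarify
      fix \<mu> :: "'s \<Rightarrow> nat" assume "m = peak \<mu>"
      then have "number Q \<circ> (nth_q Q \<circ> \<mu>) = \<mu>"
        using number_comp_nth_q[OF Q, of \<mu>] m by simp
      then show "\<mu> \<in> (\<circ>) (number Q) ` level_maps Q (Suc (peak \<mu>))"
        using level_maps_iff[OF Q m, of "nth_q Q \<circ> \<mu>"] \<open>m = peak \<mu>\<close>
        by (metis imageI)
    qed
  qed
qed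

text \<open>The list of maps at level \<open>m + 1\<close> counts from 1 and \<open>code\<close> from 0, which explains the
  successor.\<close>

lemma nth_map_code:
  fixes Q :: "nat \<Rightarrow> 'n::{finite,linorder} set" and \<nu> :: "'s::{finite,linorder} \<Rightarrow> 'n option"
  assumes Q: "Q \<in> parking_functions k" and m: "peak (number Q \<circ> \<nu>) = m" "m < CARD('n)"
  shows "nth_map Q (Suc m) (Suc (code (number Q \<circ> \<nu>) - m ^ CARD('s))) = \<nu>"
proof -
  let ?L = "level_maps Q (Suc m) :: ('s \<Rightarrow> 'n option) set"
  let ?f = "\<lambda>\<mu> :: 's \<Rightarrow> 'n option. word_of (number Q \<circ> \<mu>)"
  note bij = bij_betw_number_level[OF Q m(2), where 's = 's]
  have inj: "inj_on ?f ?L"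
    using bij_betw_imp_inj_on[OF bij] by (auto simp: inj_on_def word_of_eq_iff)
  have "bij_betw ((\<circ>) (number Q)) {\<mu> \<in> ?L. ?f \<mu> < ?f \<nu>}
    {\<mu>. peak \<mu> = m \<and> word_of \<mu> < ?f \<nu>}"
    using bij by (auto simp: bij_betw_def inj_on_def image_iff set_eq_iff) blast+
  then have "card {\<mu> \<in> ?L. ?f \<mu> < ?f \<nu>} = code (number Q \<circ> \<nu>) - m ^ CARD('s)"
    using code_eq_level_rank[of "number Q \<circ> \<nu>"] m(1) by (simp add: bij_betw_same_card)
  moreover have "increasing_list (less_lex Q) ?L ! card {\<mu> \<in> ?L. ?f \<mu> < ?f \<nu>} = \<nu>"
    using level_maps_iff[OF Q m(2)] m(1)
    by (intro increasing_list_nth_rank inj less_lex_iff[OF Q]) auto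
  ultimately show ?thesis
    by (simp add: nth_map_def)
qed

text \<open>The intervals from \<open>m ^ k\<close> to \<open>(m + 1) ^ k\<close> are disjoint for different \<open>m\<close>, hence the
  level \<open>p\<close> that the definition of \<open>position\<close> asks for is unique; dividing by 2 forgets which of the two
  blocks of a pair the state lies in.\<close>

lemma position_eq:
  fixes Q :: "nat \<Rightarrow> 'n::finite set"
  assumes Q: "Q \<in> parking_functions k"
    and c: "c = (block Q q - 1) div 2" "m ^ k \<le> c" "c < Suc m ^ k" and m: "m < CARD('n)"
  shows "position k Q q = (Suc m, Suc (c - m ^ k))"
proof -
  have char: "(case x of (p, j) \<Rightarrow> p \<in> {1..CARD('n)} \<and> j \<in> {1..p ^ k - (p - 1) ^ k} \<and>
     (q \<in> Q (2 * (p - 1) ^ k + 2 * j - 1) \<or> q \<in> Q (2 * (p - 1) ^ k + 2 * j)))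
     \<longleftrightarrow> x = (Suc m, Suc (c - m ^ k))" for x
  proof (cases x)
    case (Pair p j)
    have block: "q \<in> Q (2 * (p - 1) ^ k + 2 * j - 1) \<or> q \<in> Q (2 * (p - 1) ^ k + 2 * j)
      \<longleftrightarrow> c + 1 = (p - 1) ^ k + j" if "1 \<le> j"
      unfolding mem_parking_function_iff[OF Q] c(1) using that block_bounds(1)[OF Q, of q]
      by presburger
    show ?thesis
    proof
      assume *: "case x of (p, j) \<Rightarrow> p \<in> {1..CARD('n)} \<and> j \<in> {1..p ^ k - (p - 1) ^ k} \<and>
        (q \<in> Q (2 * (p - 1) ^ k + 2 * j - 1) \<or> q \<in> Q (2 * (p - 1) ^ k + 2 * j))"
      then have j: "1 \<le> p" "1 \<le> j" "j \<le> p ^ k - (p - 1) ^ k"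
        using Pair by auto
      then have cp: "c + 1 = (p - 1) ^ k + j"
        using * block Pair by auto
      then have "(p - 1) ^ k < Suc m ^ k" "m ^ k < p ^ k"
        using j c by linarith+
      then have "p - 1 < Suc m" "m < p"
        by (meson power_less_imp_less_base zero_le)+
      then have "p = Suc m"
        using j by linarith
      then have "j = Suc (c - m ^ k)"
        using cp c(2) by simp
      then show "x = (Suc m, Suc (c - m ^ k))"
        using Pair \<open>p = Suc m\<close> by simp
    next
      assume "x = (Suc m, Suc (c - m ^ k))"
      then have pj: "p = Suc m" "j = Suc (c - m ^ k)"
        using Pair by simp_all
      have "p \<in> {1..CARD('n)}" "1 \<le> j"
        using pj m by simp_all
      moreover have "j \<le> p ^ k - (p - 1) ^ k" "c + 1 = (p - 1) ^ k + j"
        unfolding pj diff_Suc_1 using c(2,3) by linarith+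
      ultimately show "case x of (p, j) \<Rightarrow> p \<in> {1..CARD('n)} \<and> j \<in> {1..p ^ k - (p - 1) ^ k} \<and>
        (q \<in> Q (2 * (p - 1) ^ k + 2 * j - 1) \<or> q \<in> Q (2 * (p - 1) ^ k + 2 * j))"
        using Pair block by simp
    qed
  qed
  show ?thesis
    unfolding position_def
    by (rule the_equality, rule iffD2[OF char refl], rule iffD1[OF char])
qed

text \<open>The block that a state must occupy in a parking function which induces the numbering \<open>r\<close> and
  has image \<open>(A, \<delta>)\<close> under \<open>\<zeta>\<close>: codes start at 0, blocks at 1, and each code owns an odd block for
  rejecting and the following even block for accepting states.\<close>

definition block_of :: "('n option \<Rightarrow> nat) \<Rightarrow> 'n set \<Rightarrow> ('n \<Rightarrow> 's::{finite,linorder} \<Rightarrow> 'n option)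
    \<Rightarrow> 'n \<Rightarrow> nat" where
  "block_of r A \<delta> q = 2 * code (r \<circ> \<delta> q) + (if q \<in> A then 2 else 1)"

text \<open>The block of \<open>q\<close> prescribes a code, which belongs to some map \<open>\<mu>\<close> since the codes of the maps with
  values below \<open>n\<close> exhaust the numbers below \<open>n ^ k\<close>. Reading \<open>\<mu>\<close> through the numbering gives the map
  that \<open>\<zeta>\<close> assigns to \<open>q\<close>.\<close>

lemma block_of_zeta:
  fixes Q :: "nat \<Rightarrow> 'n::{finite,linorder} set"
    and \<delta> :: "'n \<Rightarrow> 's::{finite,linorder} \<Rightarrow> 'n option"
  assumes Q: "Q \<in> parking_functions CARD('s)" and zeta: "zeta Q = (A, \<delta>)"
  shows "block_of (number Q) A \<delta> q = block Q q"
proof -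
  define c where "c = (block Q q - 1) div 2"
  have "c < CARD('n) ^ CARD('s)"
    using block_bounds[OF Q, of q] by (auto simp: c_def)
  then obtain \<mu> :: "'s \<Rightarrow> nat" where \<mu>: "code \<mu> = c" "peak \<mu> < CARD('n)"
    by (rule code_surj_on)
  define m where "m = peak \<mu>"
  define \<nu> where "\<nu> = nth_q Q \<circ> \<mu>"
  have \<nu>: "number Q \<circ> \<nu> = \<mu>"
    unfolding \<nu>_def using number_comp_nth_q[OF Q, of \<mu>] \<mu>(2) by simp
  have bounds: "m ^ CARD('s) \<le> c" "c < Suc m ^ CARD('s)"
    using code_less_power_iff[of \<mu> m] code_less_power_iff[of \<mu> "Suc m"] \<mu>(1)
    by (simp_all add: m_def del: Max_less_iff)
  have "\<delta> q = \<nu>"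
    using zeta position_eq[OF Q c_def bounds] nth_map_code[OF Q, of \<nu> m] \<mu> \<nu>
    by (auto simp: zeta_def m_def)
  moreover have "q \<in> A \<longleftrightarrow> even (block Q q)"
    using zeta mem_parking_function_iff[OF Q] block_bounds[OF Q, of q]
    by (auto simp: zeta_def accepting_def)
  ultimately show ?thesis
    using \<nu> \<mu>(1) block_bounds(1)[OF Q, of q] by (auto simp: block_of_def c_def)
qed

section \<open>Greedy numberings of an automaton\<close>

abbreviation block_key :: "('n option \<Rightarrow> nat) \<Rightarrow> 'n set
    \<Rightarrow> ('n \<Rightarrow> 's::{finite,linorder} \<Rightarrow> 'n option) \<Rightarrow> 'n \<Rightarrow> nat \<times> 'n" where
  "block_key r A \<delta> q \<equiv> (block_of r A \<delta> q, q)"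

text \<open>A stage of the greedy construction, in which the states of \<open>S\<close> have received the numbers
  \<open>1, \<dots>, card S\<close>. The last condition is the trace left by the earlier minimal choices: a state that is
  eligible now, but still unnumbered, comes after every numbered state. For
  \<open>S = UNIV\<close> the predicate describes the numberings compatible with \<open>(A, \<delta>)\<close>.\<close>

definition greedy_on :: "'n::{finite,linorder} set \<Rightarrow> ('n \<Rightarrow> 's::{finite,linorder} \<Rightarrow> 'n option)
    \<Rightarrow> 'n set \<Rightarrow> ('n option \<Rightarrow> nat) \<Rightarrow> bool" where
  "greedy_on A \<delta> S r \<longleftrightarrow>
     r None = 0 \<and> bij_betw (\<lambda>q. r (Some q)) S {1..card S} \<and>
     (\<forall>q\<in>S. range (\<delta> q) \<subseteq> insert None (Some ` S) \<and> (\<forall>a. r (\<delta> q a) < r (Some q))) \<and>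
     (\<forall>x\<in>S. \<forall>y\<in>S. r (Some x) < r (Some y) \<longrightarrow> block_key r A \<delta> x < block_key r A \<delta> y) \<and>
     (\<forall>x\<in>S. \<forall>y. y \<notin> S \<longrightarrow> range (\<delta> y) \<subseteq> insert None (Some ` S) \<longrightarrow>
        block_key r A \<delta> x < block_key r A \<delta> y)"

lemma greedy_onD:
  assumes "greedy_on A \<delta> S r"
  shows "r None = 0"
    and "bij_betw (\<lambda>q. r (Some q)) S {1..card S}"
    and "x \<in> S \<Longrightarrow> range (\<delta> x) \<subseteq> insert None (Some ` S)"
    and "x \<in> S \<Longrightarrow> r (\<delta> x a) < r (Some x)"
    and "x \<in> S \<Longrightarrow> y \<in> S \<Longrightarrow> r (Some x) < r (Some y)
      \<Longrightarrow> block_key r A \<delta> x < block_key r A \<delta> y"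
    and "x \<in> S \<Longrightarrow> y \<notin> S \<Longrightarrow> range (\<delta> y) \<subseteq> insert None (Some ` S)
      \<Longrightarrow> block_key r A \<delta> x < block_key r A \<delta> y"
  using assms unfolding greedy_on_def by (simp_all del: less_prod_simp)

lemma block_of_cong:
  assumes "\<And>a. r (\<delta> q a) = r' (\<delta> q a)"
  shows "block_of r A \<delta> q = block_of r' A \<delta> q"
proof -
  have "r \<circ> \<delta> q = r' \<circ> \<delta> q"
    using assms by auto
  then show ?thesis
    by (simp add: block_of_def)
qed

lemma block_of_less_if_peak_less:
  "peak (r \<circ> \<delta> x) < peak (r \<circ> \<delta> y) \<Longrightarrow> block_of r A \<delta> x < block_of r A \<delta> y"
  using code_less_if_peak_less[of "r \<circ> \<delta> x" "r \<circ> \<delta> y"] by (auto simp: block_of_def)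

lemma block_of_le_iff:
  fixes \<delta> :: "'n \<Rightarrow> 's::{finite,linorder} \<Rightarrow> 'n option"
  shows "block_of r A \<delta> q \<le> 2 * p ^ CARD('s) \<longleftrightarrow> (\<forall>a. r (\<delta> q a) < p)"
proof -
  have "block_of r A \<delta> q \<le> 2 * p ^ CARD('s) \<longleftrightarrow> code (r \<circ> \<delta> q) < p ^ CARD('s)"
    by (auto simp: block_of_def)
  then show ?thesis
    by (simp add: code_less_power_iff peak_less_iff)
qed

lemma block_of_determines:
  assumes "block_of r A \<delta> q = block_of r A' \<delta>' q" and "inj r"
  shows "q \<in> A \<longleftrightarrow> q \<in> A'" and "\<delta> q = \<delta>' q"
proof -
  have eq: "2 * code (r \<circ> \<delta> q) + (if q \<in> A then 2 else 1)
    = 2 * code (r \<circ> \<delta>' q) + (if q \<in> A' then 2 else 1)"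
    using assms(1) by (simp add: block_of_def)
  then show "q \<in> A \<longleftrightarrow> q \<in> A'"
    by (auto split: if_splits) presburger+
  then have "r \<circ> \<delta> q = r \<circ> \<delta>' q"
    using eq by (simp add: code_eq_iff)
  then show "\<delta> q = \<delta>' q"
    using assms(2) by (simp add: fun_eq_iff inj_eq)
qed

text \<open>By acyclicity some state outside \<open>S\<close> has all its transitions into \<open>S\<close> or to the absorbing
  state; among these the one with the least block key is taken. Keys of states of this kind do not
  involve the new number. A state that becomes eligible only now has a transition to the new state, so
  its maximum, and with it its block, exceeds those of all numbered states.\<close>

lemma greedy_on_extend:
  fixes \<delta> :: "'n::{finite,linorder} \<Rightarrow> 's::{finite,linorder} \<Rightarrow> 'n option"
  assumes greedy: "greedy_on A \<delta> S r" and "S \<noteq> UNIV" and acyclic: "acyclic (transitions \<delta>)"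
  obtains q where "q \<notin> S" "greedy_on A \<delta> (insert q S) (r(Some q := Suc (card S)))"
proof -
  define C where "C = {y. y \<notin> S \<and> range (\<delta> y) \<subseteq> insert None (Some ` S)}"
  have "wf ((transitions \<delta>)\<inverse>)"
    using acyclic by (intro finite_acyclic_wf_converse) auto
  moreover obtain w where "w \<in> - S"
    using \<open>S \<noteq> UNIV\<close> by blast
  ultimately obtain z where "z \<in> - S" "\<And>y. (y, z) \<in> (transitions \<delta>)\<inverse> \<Longrightarrow> y \<notin> - S"
    by (rule wfE_min) blast
  then have z: "z \<notin> S" "\<And>y. (z, y) \<in> transitions \<delta> \<Longrightarrow> y \<in> S"
    by blast+
  have "\<delta> z a \<in> insert None (Some ` S)" for a
    using z(2) by (cases "\<delta> z a") (auto simp: transitions_def)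
  then have "z \<in> C"
    using z(1) unfolding C_def by (simp add: image_subset_iff)
  then have "C \<noteq> {}"
    by blast
  then obtain q where q: "is_arg_min (block_key r A \<delta>) (\<lambda>y. y \<in> C) q"
    using ex_is_arg_min_if_finite[OF finite, of C "block_key r A \<delta>"] by blast
  then have "q \<in> C"
    by (simp add: is_arg_min_def)
  have qS: "q \<notin> S" and q_ready: "range (\<delta> q) \<subseteq> insert None (Some ` S)"
    using \<open>q \<in> C\<close> by (simp_all add: C_def)
  have q_min: "block_key r A \<delta> q < block_key r A \<delta> y" if "y \<in> C" "y \<noteq> q" for y
  proof -
    have "\<not> block_key r A \<delta> y < block_key r A \<delta> q"
      using q \<open>y \<in> C\<close> unfolding is_arg_min_def by blast
    moreover have "block_key r A \<delta> y \<noteq> block_key r A \<delta> q"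
      using \<open>y \<noteq> q\<close> by simp
    ultimately show ?thesis
      using linorder_less_linear by blast
  qed

  define r' where "r' = r(Some q := Suc (card S))"
  note r0 = greedy_onD(1)[OF greedy] and bij = greedy_onD(2)[OF greedy]
    and closed = greedy_onD(3)[OF greedy] and down = greedy_onD(4)[OF greedy]
    and order = greedy_onD(5)[OF greedy] and later = greedy_onD(6)[OF greedy]
  have r'_S: "r' (Some x) = r (Some x)" if "x \<in> S" for x
    using that qS by (auto simp: r'_def)
  have r'_q: "r' (Some q) = Suc (card S)"
    by (simp add: r'_def)
  have r_le: "r x \<le> card S" if "x \<in> insert None (Some ` S)" for x
    using that r0 bij_betwE[OF bij] by auto
  have r'_eq: "r' x = r x" if "x \<in> insert None (Some ` S)" for x
    using that qS by (auto simp: r'_def)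
  have r'_ready: "r' (\<delta> x a) = r (\<delta> x a)" if "range (\<delta> x) \<subseteq> insert None (Some ` S)" for x a
    using r'_eq that by blast
  have key: "block_key r' A \<delta> x = block_key r A \<delta> x"
    if "range (\<delta> x) \<subseteq> insert None (Some ` S)" for x
    using block_of_cong[of r' \<delta> x r A] r'_ready[OF that] by simp
  have ready: "range (\<delta> x) \<subseteq> insert None (Some ` S)" if "x \<in> insert q S" for x
    using that closed q_ready by (cases "x = q") simp_all

  have "greedy_on A \<delta> (insert q S) r'"
    unfolding greedy_on_def
  proof (intro conjI ballI allI impI)
    show "r' None = 0"
      by (simp add: r'_def r0)
    have "bij_betw (\<lambda>q. r' (Some q)) S {1..card S}"
      by (rule iffD2[OF bij_betw_cong bij]) (rule r'_S)
    then show "bij_betw (\<lambda>q. r' (Some q)) (insert q S) {1..card (insert q S)}"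
      using notIn_Un_bij_betw[of q S "\<lambda>q. r' (Some q)" "{1..card S}"] qS r'_q
      by (simp add: atLeastAtMostSuc_conv)
  next
    fix x assume "x \<in> insert q S"
    then show "range (\<delta> x) \<subseteq> insert None (Some ` insert q S)"
      by (rule order_trans[OF ready]) auto
  next
    fix x a assume x: "x \<in> insert q S"
    note x_ready = ready[OF x]
    show "r' (\<delta> x a) < r' (Some x)"
    proof (cases "x = q")
      case True
      have "r (\<delta> x a) \<le> card S"
        using x_ready by (intro r_le) (simp add: image_subset_iff)
      then show ?thesis
        using r'_ready[OF x_ready] r'_q True by simp
    next
      case False
      then show ?thesis
        using r'_ready[OF x_ready] r'_S down x by simp
    qed
  next
    fix x y assume xy: "x \<in> insert q S" "y \<in> insert q S" "r' (Some x) < r' (Some y)"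
    have "x \<in> S"
    proof (rule ccontr)
      assume "x \<notin> S"
      then have "r' (Some x) = Suc (card S)"
        using xy r'_q by simp
      moreover have "r' (Some y) \<le> Suc (card S)"
        using xy(2) r'_q r'_S r_le[of "Some y"] by fastforce
      ultimately show False
        using xy(3) by simp
    qed
    then have "block_key r A \<delta> x < block_key r A \<delta> y"
      using xy(2,3) order[of x y] later[OF _ qS q_ready, of x] r'_S by (cases "y = q") simp_all
    then show "block_key r' A \<delta> x < block_key r' A \<delta> y"
      by (simp only: key[OF ready[OF xy(1)]] key[OF ready[OF xy(2)]])
  next
    fix x y assume x: "x \<in> insert q S" and y: "y \<notin> insert q S"
      and y_ready: "range (\<delta> y) \<subseteq> insert None (Some ` insert q S)"
    note x_ready = ready[OF x]
    show "block_key r' A \<delta> x < block_key r' A \<delta> y"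
    proof (cases "range (\<delta> y) \<subseteq> insert None (Some ` S)")
      case True
      then have "block_key r A \<delta> x < block_key r A \<delta> y"
        using x y later[of x y] q_min[of y] by (cases "x = q") (simp_all add: C_def)
      then show ?thesis
        by (simp only: key[OF True] key[OF x_ready])
    next
      case False
      then obtain a where "\<delta> y a = Some q"
        using y_ready by auto
      then have "\<not> peak (r' \<circ> \<delta> y) < Suc (card S)"
        using r'_q peak_less_iff[of "r' \<circ> \<delta> y" "Suc (card S)"] by (metis comp_apply less_irrefl)
      moreover have "r (\<delta> x b) \<le> card S" for b
        using x_ready by (intro r_le) (simp add: image_subset_iff)
      then have "peak (r' \<circ> \<delta> x) < Suc (card S)"
        using r'_ready[OF x_ready] unfolding peak_less_iff by (simp add: less_Suc_eq_le)
      ultimately show ?thesis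
        using block_of_less_if_peak_less[of r' \<delta> x y A] by simp
    qed
  qed
  then show ?thesis
    using that qS by (simp add: r'_def)
qed

lemma greedy_exists:
  fixes \<delta> :: "'n::{finite,linorder} \<Rightarrow> 's::{finite,linorder} \<Rightarrow> 'n option"
  assumes "acyclic (transitions \<delta>)"
  obtains r where "greedy_on A \<delta> UNIV r"
proof -
  have "\<exists>S r. card S = m \<and> greedy_on A \<delta> S r" if "m \<le> CARD('n)" for m
    using that
  proof (induction m)
    case 0
    have "greedy_on A \<delta> {} (\<lambda>_. 0)"
      by (simp add: greedy_on_def bij_betw_def)
    then show ?case
      by (intro exI[of _ "{}"]) auto
  next
    case (Suc m)
    then obtain S r where S: "card S = m" "greedy_on A \<delta> S r"
      by auto
    then have "S \<noteq> UNIV"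
      using Suc.prems by auto
    then obtain q where "q \<notin> S" "greedy_on A \<delta> (insert q S) (r(Some q := Suc (card S)))"
      using greedy_on_extend[OF S(2) _ assms] by blast
    then show ?case
      using S(1) by (intro exI[of _ "insert q S"]) auto
  qed
  then obtain S r where "card S = CARD('n)" "greedy_on A \<delta> S r"
    by blast
  moreover from this have "S = UNIV"
    by (intro card_subset_eq) auto
  ultimately show ?thesis
    using that by blast
qed

text \<open>Suppose that the numberings agree below \<open>m\<close> but give the number \<open>m\<close> to two different states.
  The transitions of both states stay below \<open>m\<close>, so both numberings assign them the same keys; yet each
  numbering places its own choice first, so the keys would be ordered both ways.\<close>

lemma greedy_unique:
  fixes \<delta> :: "'n::{finite,linorder} \<Rightarrow> 's::{finite,linorder} \<Rightarrow> 'n option"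
  assumes r: "greedy_on A \<delta> UNIV r" and r': "greedy_on A \<delta> UNIV r'"
  shows "r = r'"
proof -
  have agree: "\<forall>x. r x = m \<longleftrightarrow> r' x = m" for m
  proof (induction m rule: less_induct)
    case (less m)
    have two_states: "x = y" if gr: "greedy_on A \<delta> UNIV r" "greedy_on A \<delta> UNIV r'"
      and IH: "\<And>i. i < m \<Longrightarrow> \<forall>x. r x = i \<longleftrightarrow> r' x = i"
      and xy: "r (Some x) = m" "r' (Some y) = m" for r r' x y
    proof (rule ccontr)
      assume "x \<noteq> y"
      have below: "r' z = r z" if "r z < m \<or> r' z < m" for z
        using that IH[THEN spec, of "r z" z] IH[THEN spec, of "r' z" z] by auto
      have "r (\<delta> x a) < m" "r' (\<delta> y a) < m" for a
        using greedy_onD(4)[OF gr(1) UNIV_I, of x a] greedy_onD(4)[OF gr(2) UNIV_I, of y a] xy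
        by simp_all
      then have key: "block_of r' A \<delta> x = block_of r A \<delta> x" "block_of r' A \<delta> y = block_of r A \<delta> y"
        using below by (intro block_of_cong; blast)+
      have inj: "inj (\<lambda>q. r (Some q))" "inj (\<lambda>q. r' (Some q))"
        using greedy_onD(2)[OF gr(1)] greedy_onD(2)[OF gr(2)] by (simp_all add: bij_betw_def)
      have "r (Some y) \<noteq> m" "r' (Some x) \<noteq> m"
        using \<open>x \<noteq> y\<close> xy injD[OF inj(1), of x y] injD[OF inj(2), of x y] by auto
      moreover have "\<not> r (Some y) < m" "\<not> r' (Some x) < m"
        using below[of "Some y"] below[of "Some x"] xy calculation by auto
      ultimately have "r (Some x) < r (Some y)" "r' (Some y) < r' (Some x)"
        using xy by auto
      then have "block_key r A \<delta> x < block_key r A \<delta> y" "block_key r' A \<delta> y < block_key r' A \<delta> x"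
        using greedy_onD(5)[OF gr(1) UNIV_I UNIV_I] greedy_onD(5)[OF gr(2) UNIV_I UNIV_I] by blast+
      then show False
        using key by auto
    qed
    have transfer: "r' x = m" if gr: "greedy_on A \<delta> UNIV r" "greedy_on A \<delta> UNIV r'"
      and IH: "\<And>i. i < m \<Longrightarrow> \<forall>x. r x = i \<longleftrightarrow> r' x = i"
      and x: "r x = m" for r r' x
    proof (cases x)
      case None
      then show ?thesis
        using greedy_onD(1)[OF gr(1)] greedy_onD(1)[OF gr(2)] x by simp
    next
      case (Some a)
      then have "m \<in> {1..CARD('n)}"
        using bij_betwE[OF greedy_onD(2)[OF gr(1)]] x by blast
      then obtain b where "r' (Some b) = m"
        using bij_betw_imp_surj_on[OF greedy_onD(2)[OF gr(2)]] by (metis imageE)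
      then show ?thesis
        using two_states[OF gr IH, of a b] x Some by simp
    qed
    show ?case
      using transfer[OF r r' less] transfer[OF r' r] less by metis
  qed
  show ?thesis
  proof
    fix x show "r x = r' x"
      using agree[of "r x"] by metis
  qed
qed

lemma acyclic_if_greedy:
  assumes "greedy_on A \<delta> UNIV r"
  shows "acyclic (transitions \<delta>)"
proof -
  have "r (\<delta> q a) < r (Some q)" for q a
    using greedy_onD(4)[OF assms UNIV_I] .
  then have "(transitions \<delta>)\<inverse> \<subseteq> measure (\<lambda>q. r (Some q))"
    unfolding transitions_def by clarsimp metis
  then have "acyclic ((transitions \<delta>)\<inverse>)"
    by (meson acyclic_subset wf_acyclic wf_measure)
  then show ?thesis
    by (simp add: acyclic_converse)
qed

section \<open>Parking functions are greedily numbered automata\<close>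

text \<open>The parking condition enters in the proof that transitions decrease the number. If the state
  with number \<open>p\<close> were beyond the first \<open>2 p\<^sup>k\<close> blocks, then the states in these blocks, of which there
  are at least \<open>p\<close>, would all precede it.\<close>

lemma greedy_number:
  fixes Q :: "nat \<Rightarrow> 'n::{finite,linorder} set"
    and \<delta> :: "'n \<Rightarrow> 's::{finite,linorder} \<Rightarrow> 'n option"
  assumes Q: "Q \<in> parking_functions CARD('s)" and zeta: "zeta Q = (A, \<delta>)"
  shows "greedy_on A \<delta> UNIV (number Q)"
proof -
  note block = block_of_zeta[OF Q zeta]
  have down: "number Q (\<delta> q a) < number Q (Some q)" for q a
  proof -
    define p where "p = number Q (Some q)"
    have "p \<in> range (number Q)" "1 \<le> p"
      unfolding p_def by (rule rangeI) simp
    then have "p \<in> {1..CARD('n)}"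
      by (simp add: range_number)
    then have "p \<le> (\<Sum>j=1..2 * p ^ CARD('s). card (Q j))"
      using Q unfolding parking_functions_def by blast
    also have "\<dots> = card {x. block Q x \<le> 2 * p ^ CARD('s)}"
      using mem_parking_function_iff[OF Q] block_bounds(1)[OF Q]
      by (intro sum_card_eq_card_block_le)
    finally have many: "p \<le> card {x. block Q x \<le> 2 * p ^ CARD('s)}" .
    have "block Q q \<le> 2 * p ^ CARD('s)"
    proof (rule ccontr)
      assume "\<not> block Q q \<le> 2 * p ^ CARD('s)"
      then have "{x. block Q x \<le> 2 * p ^ CARD('s)} \<subseteq> {x. (block Q x, x) < (block Q q, q)}"
        by auto
      then have "card {x. block Q x \<le> 2 * p ^ CARD('s)} < p"
        unfolding p_def number_simps by (intro le_imp_less_Suc card_mono) auto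
      then show False
        using many by simp
    qed
    then show ?thesis
      using block_of_le_iff[of "number Q" A \<delta> q p] block by (simp add: p_def)
  qed
  have "range (\<lambda>q. number Q (Some q)) = {1..CARD('n)}"
  proof -
    have "range (number Q) = insert 0 (range (\<lambda>q. number Q (Some q)))"
      by (simp add: UNIV_option_conv image_image del: number_simps(2))
    moreover have "0 \<notin> range (\<lambda>q. number Q (Some q))"
      by auto
    ultimately have "range (\<lambda>q. number Q (Some q)) = {0..CARD('n)} - {0}"
      by (metis Diff_insert_absorb range_number)
    then show ?thesis
      by auto
  qed
  moreover have "inj (\<lambda>q. number Q (Some q))"
    using inj_number[of Q] by (auto intro!: injI dest: injD simp del: number_simps)
  moreover have "range (\<delta> q) \<subseteq> insert None (range Some)" for q
    by (simp flip: UNIV_option_conv)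
  ultimately show ?thesis
    unfolding greedy_on_def bij_betw_def
    using down by (auto simp: block number_less_iff simp del: number_simps(2))
qed

text \<open>The blocks are the fibres of \<open>block_of\<close>. The states numbered \<open>1, \<dots>, p\<close> have transitions
  to numbers below \<open>p\<close> only and so lie in the first \<open>2 p\<^sup>k\<close> blocks, which is the parking condition. As
  the numbering respects the block keys, it is the one that the parking function induces.\<close>

lemma parking_function_of_greedy:
  fixes \<delta> :: "'n::{finite,linorder} \<Rightarrow> 's::{finite,linorder} \<Rightarrow> 'n option"
  assumes greedy: "greedy_on A \<delta> UNIV r"
  obtains Q where "Q \<in> parking_functions CARD('s)" "zeta Q = (A, \<delta>)"
proof -
  define Q where "Q = (\<lambda>j. {q. block_of r A \<delta> q = j})"
  note r0 = greedy_onD(1)[OF greedy] and bij = greedy_onD(2)[OF greedy]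
    and down = greedy_onD(4)[OF greedy UNIV_I]
    and order = greedy_onD(5)[OF greedy UNIV_I UNIV_I]
  have mem: "q \<in> Q j \<longleftrightarrow> block_of r A \<delta> q = j" for q j
    by (simp add: Q_def)
  have r_bounds: "1 \<le> r (Some q)" "r (Some q) \<le> CARD('n)" for q
    using bij_betwE[OF bij] by auto
  have le_if_number_le: "block_of r A \<delta> q \<le> 2 * p ^ CARD('s)" if "r (Some q) \<le> p" for q p
    unfolding block_of_le_iff using down[of q] that by (meson less_le_trans)
  have bounds: "1 \<le> block_of r A \<delta> q" "block_of r A \<delta> q \<le> 2 * CARD('n) ^ CARD('s)" for q
    using le_if_number_le r_bounds by (simp_all add: block_of_def)
  have Q: "Q \<in> parking_functions CARD('s)"
    unfolding parking_functions_def
  proof (intro CollectI conjI allI impI ballI)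
    fix j assume "j \<notin> {1..2 * CARD('n) ^ CARD('s)}"
    then show "Q j = {}"
      using bounds by (auto simp: mem)
  next
    show "disjoint_family_on Q {1..2 * CARD('n) ^ CARD('s)}"
      by (auto simp: disjoint_family_on_def mem)
    show "(\<Union>j\<in>{1..2 * CARD('n) ^ CARD('s)}. Q j) = UNIV"
      using bounds by (auto simp: mem)
  next
    fix p assume p: "p \<in> {1..CARD('n)}"
    have "(\<lambda>q. r (Some q)) ` {q. r (Some q) \<le> p} = {1..p}"
      using bij p by (auto simp: bij_betw_def image_iff set_eq_iff) (metis le_trans)+
    then have "p \<le> card {q. r (Some q) \<le> p}"
      using card_image_le[of "{q. r (Some q) \<le> p}" "\<lambda>q. r (Some q)"] by simp
    also have "\<dots> \<le> card {q. block_of r A \<delta> q \<le> 2 * p ^ CARD('s)}"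
      using le_if_number_le by (intro card_mono) auto
    also have "\<dots> = (\<Sum>j=1..2 * p ^ CARD('s). card (Q j))"
      using mem bounds(1) by (intro sum_card_eq_card_block_le[symmetric])
    finally show "p \<le> (\<Sum>j=1..2 * p ^ CARD('s). card (Q j))" .
  qed
  have block: "block Q q = block_of r A \<delta> q" for q
    using mem mem_parking_function_iff[OF Q] by blast
  have inj_Some: "inj (\<lambda>q. r (Some q))"
    using bij by (simp add: bij_betw_def)
  have key_iff: "(block Q x, x) < (block Q y, y) \<longleftrightarrow> r (Some x) < r (Some y)" for x y
  proof (cases "r (Some x)" "r (Some y)" rule: linorder_cases)
    case less
    then show ?thesis
      using order block by simp
  next
    case equal
    then show ?thesis
      using inj_Some by (auto dest: injD)
  next
    case greater
    then have "block_key r A \<delta> y < block_key r A \<delta> x"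
      by (rule order)
    then show ?thesis
      using greater unfolding block by (meson order.asym)
  qed
  have number: "number Q = r"
  proof
    fix x show "number Q x = r x"
    proof (cases x)
      case (Some q)
      have "(\<lambda>q. r (Some q)) ` {y. r (Some y) < r (Some q)} = {1..<r (Some q)}"
        using bij r_bounds(2)[of q]
        by (auto simp: bij_betw_def image_iff set_eq_iff) (metis less_imp_le order_trans)+
      then have "card {y. r (Some y) < r (Some q)} = r (Some q) - 1"
        using card_image[of "\<lambda>q. r (Some q)" "{y. r (Some y) < r (Some q)}"]
          inj_on_subset[OF inj_Some] by simp
      then show ?thesis
        using Some r_bounds(1)[of q] by (simp add: key_iff del: less_prod_simp)
    qed (simp add: r0)
  qed
  obtain A' \<delta>' where zeta: "zeta Q = (A', \<delta>' :: 'n \<Rightarrow> 's \<Rightarrow> 'n option)"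
    by fastforce
  have "block_of r A' \<delta>' q = block_of r A \<delta> q" for q
    using block_of_zeta[OF Q zeta] block number by simp
  then have "q \<in> A' \<longleftrightarrow> q \<in> A" "\<delta>' q = \<delta> q" for q
    using block_of_determines inj_number[of Q] unfolding number by metis+
  then have "zeta Q = (A, \<delta>)"
    unfolding zeta by auto
  then show ?thesis
    using that Q by blast
qed

theorem lemma3:
  "bij_betw
     (zeta :: (nat \<Rightarrow> 'n::{finite,linorder} set) \<Rightarrow> ('n, 's::{finite,linorder}) automaton)
     (parking_functions CARD('s))
     non_initial_adfas"
proof (rule bij_betw_imageI)
  let ?zeta = "zeta :: (nat \<Rightarrow> 'n set) \<Rightarrow> ('n, 's) automaton"
  show "inj_on ?zeta (parking_functions CARD('s))"
  proof (rule inj_onI)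
    fix Q Q' :: "nat \<Rightarrow> 'n set"
    assume Q: "Q \<in> parking_functions CARD('s)" and Q': "Q' \<in> parking_functions CARD('s)"
      and eq: "?zeta Q = ?zeta Q'"
    obtain A \<delta> where zeta: "?zeta Q = (A, \<delta>)"
      by fastforce
    then have zeta': "?zeta Q' = (A, \<delta>)"
      using eq by simp
    have "number Q = number Q'"
      using greedy_number[OF Q zeta] greedy_number[OF Q' zeta'] by (rule greedy_unique)
    then have "block Q q = block Q' q" for q
      using block_of_zeta[OF Q zeta] block_of_zeta[OF Q' zeta'] by metis
    then show "Q = Q'"
      using mem_parking_function_iff[OF Q] mem_parking_function_iff[OF Q'] by (auto simp: fun_eq_iff)
  qed
  show "?zeta ` parking_functions CARD('s) = non_initial_adfas"
  proof
    show "?zeta ` parking_functions CARD('s) \<subseteq> non_initial_adfas"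
    proof
      fix X assume "X \<in> ?zeta ` parking_functions CARD('s)"
      then obtain Q A \<delta> where Q: "Q \<in> parking_functions CARD('s)" "?zeta Q = (A, \<delta>)"
        and X: "X = (A, \<delta>)"
        by (metis imageE surj_pair)
      then show "X \<in> non_initial_adfas"
        using acyclic_if_greedy[OF greedy_number[OF Q]] by (simp add: non_initial_adfas_def)
    qed
    show "non_initial_adfas \<subseteq> ?zeta ` parking_functions CARD('s)"
    proof
      fix X :: "('n, 's) automaton" assume "X \<in> non_initial_adfas"
      then obtain A \<delta> where X: "X = (A, \<delta>)" and "acyclic (transitions \<delta>)"
        by (auto simp: non_initial_adfas_def)
      then obtain r where "greedy_on A \<delta> UNIV r"
        using greedy_exists by blast
      then show "X \<in> ?zeta ` parking_functions CARD('s)"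
        unfolding X by (metis parking_function_of_greedy imageI)
    qed
  qed
qed

end
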